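(* Let $x_N$ be an output generated by the universal method UM given $f$, $x_0$ and $N\in\mathbb N$. 1. If $(f,x_0)$ is a $(\mathcal C_M,R_x)$-input for some real $M\ge0$ and $R_x\ge0$, then $$f(x_N)-f_*\le\frac{MR_x}{\sqrt{N+1}}.$$ 2. If $(f,x_0)$ is an $(\mathcal F_{0,L},R_x)$-input for some real $L>0$ and $R_x\ge0$, then $$f(x_N)-f_*\le\frac{LR_x^2}{2\theta_{N,N}^2}.$$
   Context: $\langle\cdot,\cdot\rangle$, $\|\cdot\|$ are the Euclidean inner product and norm on $\mathbb R^d$; $\mathbb N$ denotes the positive integers; $f_*:=\min f$. $\mathcal C_M=\mathcal C_M(\mathbb R^d)$ is the class of (Lipschitz) closed, convex and proper functions $f$ on $\mathbb R^d$ such that $\|g\|\le M$ for all $x$ and all $g\in\partial f(x)$. $\mathcal F_{0,L}=\mathcal F_{0,L}(\mathbb R^d)$ is the class of convex functions on $\mathbb R^d$ that are differentiable with $L$-Lipschitz gradient. For a class $\mathcal F$, $(f,x_0)$ is an $(\mathcal F,R_x)$-input if $f\in\mathcal F$, $x_0\in\mathbb R^d$ and $\|x_0-x_*\|\le R_x$ for some $x_*\in\operatorname{argmin}f$. For $N\ge1$: $\theta_{0,N}:=1$, $\theta_{i+1,N}:=\frac{1+\sqrt{4\theta_{i,N}^2+1}}2$ for $0\le i\le N-2$, and $\theta_{N,N}:=\frac{1+\sqrt{8\theta_{N-1,N}^2+1}}2$. Universal method (UM) (input $f,x_0,N$): pick any $f'(x_0)\in\partial f(x_0)$; for $i=1,\dots,N$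 set $$y^{(1)}_i=\frac{i}{i+1}x_{i-1}+\frac1{i+1}x_0,\qquad d^{(1)}_i=\frac1{i+1}\sum_{j=0}^{i-1}f'(x_j),$$ $$y^{(2)}_i=\Big(1-\frac1{\theta_{i,N}}\Big)x_{i-1}+\frac1{\theta_{i,N}}x_0,\qquad d^{(2)}_i=\Big(1-\frac1{\theta_{i,N}}\Big)f'(x_{i-1})+\frac2{\theta_{i,N}}\sum_{j=0}^{i-1}\theta_{j,N}f'(x_j),$$ $$(\alpha,\beta,\gamma)\in\operatorname*{argmin}_{\alpha,\beta,\gamma\in\mathbb R}f\big(\alpha y^{(1)}_i+(1-\alpha)y^{(2)}_i-\beta d^{(1)}_i-\gamma d^{(2)}_i\big),$$ $$x_i=\alpha y^{(1)}_i+(1-\alpha)y^{(2)}_i-\beta d^{(1)}_i-\gamma d^{(2)}_i,$$ and choose $f'(x_i)\in\partial f(x_i)$ such that $\langle f'(x_i),y^{(1)}_i-y^{(2)}_i\rangle=\langle f'(x_i),d^{(1)}_i\rangle=\langle f'(x_i),d^{(2)}_i\rangle=0$. The output is $x_N$ (the minima are assumed attained). *)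

theory Defs
  imports "HOL-Analysis.Analysis"
begin

section \<open>Extended-valued convex functions\<close>

text \<open>The library's \<open>epigraph\<close> and \<open>convex_on\<close> are for real-valued functions only; the
  functions here may take the value \<open>\<infinity>\<close>.\<close>

definition epi :: "('a \<Rightarrow> ereal) \<Rightarrow> ('a \<times> real) set"
  where "epi f = {(x, r). f x \<le> ereal r}"

definition proper_fun :: "('a \<Rightarrow> ereal) \<Rightarrow> bool"
  where "proper_fun f \<longleftrightarrow> (\<exists>x. f x < \<infinity>) \<and> (\<forall>x. f x > -\<infinity>)"

definition convex_fun :: "('a::real_vector \<Rightarrow> ereal) \<Rightarrow> bool"
  where "convex_fun f \<longleftrightarrow> convex (epi f)"

definition closed_fun :: "('a::topological_space \<Rightarrow> ereal) \<Rightarrow> bool"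
  where "closed_fun f \<longleftrightarrow> closed (epi f)"

text \<open>For proper \<open>f\<close> this set is empty at every point where \<open>f\<close> is infinite.\<close>

definition subdiff :: "('a::real_inner \<Rightarrow> ereal) \<Rightarrow> 'a \<Rightarrow> 'a set"
  where "subdiff f x = {g. \<forall>y. f y \<ge> f x + ereal (g \<bullet> (y - x))}"

definition argmin :: "('a \<Rightarrow> ereal) \<Rightarrow> 'a set"
  where "argmin f = {x. is_arg_min f (\<lambda>_. True) x}"

text \<open>The infimum, which is the minimum whenever \<^term>\<open>argmin f\<close> is nonempty.\<close>

definition min_val :: "('a \<Rightarrow> ereal) \<Rightarrow> ereal"
  where "min_val f = (INF x. f x)"

lemma min_val_eq:
  assumes "x \<in> argmin f"
  shows "min_val f = f x"
  using assms unfolding min_val_def argmin_def is_arg_min_linorder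
  by (auto intro!: antisym INF_lower INF_greatest)


section \<open>Function classes and inputs\<close>

definition class_C :: "real \<Rightarrow> ('a::euclidean_space \<Rightarrow> ereal) set"
  where "class_C M = {f. closed_fun f \<and> convex_fun f \<and> proper_fun f \<and>
           (\<forall>x. \<forall>g\<in>subdiff f x. norm g \<le> M)}"

definition class_F :: "real \<Rightarrow> ('a::euclidean_space \<Rightarrow> ereal) set"
  where "class_F L = {f. \<exists>(h :: 'a \<Rightarrow> real) G. f = (\<lambda>x. ereal (h x)) \<and> convex_on UNIV h \<and>
           (\<forall>x. GDERIV h x :> G x) \<and> L-lipschitz_on UNIV G}"

definition is_input ::
    "('a::euclidean_space \<Rightarrow> ereal) set \<Rightarrow> real \<Rightarrow> ('a \<Rightarrow> ereal) \<Rightarrow> 'a \<Rightarrow> bool"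
  where "is_input \<F> R f x0 \<longleftrightarrow> f \<in> \<F> \<and> (\<exists>xs\<in>argmin f. norm (x0 - xs) \<le> R)"


section \<open>The universal method\<close>

text \<open>\<open>theta N i\<close> is \<open>\<theta>\<^sub>i\<^sub>,\<^sub>N\<close>, meant for \<open>i \<le> N\<close> and \<open>N \<ge> 1\<close>; only the last step uses
  the factor 8.\<close>

fun theta :: "nat \<Rightarrow> nat \<Rightarrow> real"
  where
    "theta N 0 = 1"
  | "theta N (Suc i) =
       (if Suc i = N then (1 + sqrt (8 * (theta N i)\<^sup>2 + 1)) / 2
        else (1 + sqrt (4 * (theta N i)\<^sup>2 + 1)) / 2)"

text \<open>Below, \<open>x i\<close> are the iterates and \<open>g i\<close> is the subgradient \<open>f'(x\<^sub>i)\<close> picked in step \<open>i\<close>.\<close>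

definition y1 :: "(nat \<Rightarrow> 'a::real_vector) \<Rightarrow> nat \<Rightarrow> 'a"
  where "y1 x i = (real i / real (i + 1)) *\<^sub>R x (i - 1) + (1 / real (i + 1)) *\<^sub>R x 0"

definition d1 :: "(nat \<Rightarrow> 'a::real_vector) \<Rightarrow> nat \<Rightarrow> 'a"
  where "d1 g i = (1 / real (i + 1)) *\<^sub>R (\<Sum>j<i. g j)"

definition y2 :: "nat \<Rightarrow> (nat \<Rightarrow> 'a::real_vector) \<Rightarrow> nat \<Rightarrow> 'a"
  where "y2 N x i = (1 - 1 / theta N i) *\<^sub>R x (i - 1) + (1 / theta N i) *\<^sub>R x 0"

definition d2 :: "nat \<Rightarrow> (nat \<Rightarrow> 'a::real_vector) \<Rightarrow> nat \<Rightarrow> 'a"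
  where "d2 N g i = (1 - 1 / theta N i) *\<^sub>R g (i - 1) +
           (2 / theta N i) *\<^sub>R (\<Sum>j<i. theta N j *\<^sub>R g j)"

definition um_point :: "nat \<Rightarrow> (nat \<Rightarrow> 'a::real_vector) \<Rightarrow> (nat \<Rightarrow> 'a) \<Rightarrow> nat \<Rightarrow> real \<times> real \<times> real \<Rightarrow> 'a"
  where "um_point N x g i = (\<lambda>(\<alpha>, \<beta>, \<gamma>).
           \<alpha> *\<^sub>R y1 x i + (1 - \<alpha>) *\<^sub>R y2 N x i - \<beta> *\<^sub>R d1 g i - \<gamma> *\<^sub>R d2 N g i)"

definition um_step ::
    "('a::euclidean_space \<Rightarrow> ereal) \<Rightarrow> nat \<Rightarrow> (nat \<Rightarrow> 'a) \<Rightarrow> (nat \<Rightarrow> 'a) \<Rightarrow> nat \<Rightarrow> bool"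
  where "um_step f N x g i \<longleftrightarrow>
           (\<exists>p\<in>argmin (\<lambda>p. f (um_point N x g i p)). x i = um_point N x g i p) \<and>
           g i \<in> subdiff f (x i) \<and>
           g i \<bullet> (y1 x i - y2 N x i) = 0 \<and> g i \<bullet> d1 g i = 0 \<and> g i \<bullet> d2 N g i = 0"

definition um_output :: "('a::euclidean_space \<Rightarrow> ereal) \<Rightarrow> 'a \<Rightarrow> nat \<Rightarrow> 'a \<Rightarrow> bool"
  where "um_output f x0 N xN \<longleftrightarrow>
           (\<exists>x g. x 0 = x0 \<and> g 0 \<in> subdiff f (x 0) \<and> (\<forall>i\<in>{1..N}. um_step f N x g i) \<and> xN = x N)"

end

theory Submission
  imports Defs
begin

text \<open>Each step with \<open>i \<ge> 1\<close> acts on the error through orthogonality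
  relations: \<open>g i\<close> is orthogonal to \<open>x i - y1 x i\<close>, \<open>x i - y2 N x i\<close>, \<open>d1 g i\<close> and
  \<open>d2 N g i\<close>. Write \<open>F i = f (x i)\<close>, let \<open>xs\<close> be a minimizer and \<open>Fs = f xs\<close>.

  The pair \<open>y1, d1\<close> serves the Lipschitz case. Adding \<open>i\<close> times the subgradient inequality
  from \<open>x i\<close> to \<open>x (i - 1)\<close> and once the one from \<open>x i\<close> to \<open>xs\<close>, over all \<open>i \<le> N\<close>, the function
  values telescope to \<open>(N + 1) * (F N - Fs)\<close>, and orthogonality to \<open>x i - y1 x i\<close> turns the
  other side into \<open>(\<Sum>i\<le>N. g i) \<bullet> (x 0 - xs)\<close> (lemma \<open>averaged_subgradient_bound\<close>). Since
  every subgradient is orthogonal to the sum of its predecessors, Pythagoras gives this sum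
  norm at most \<open>M * sqrt (N + 1)\<close> (lemma \<open>norm_sum_subgradients_le\<close>), and Cauchy-Schwarz
  concludes.

  The pair \<open>y2, d2\<close> serves the smooth case. The optimized gradient method would take
  \<open>x i = y2 N x i - (1 / L) *\<^sub>R d2 N g i\<close>. The iterates here need not satisfy this equation, but
  they satisfy its inner product with \<open>g i\<close> for every \<open>L\<close> at once, and it is this scalar
  equation that enters the potential argument for that method (lemmas \<open>ogm_potential_bound\<close> and
  \<open>ogm_final_bound\<close>). The argument combines subgradient
  inequalities strengthened by a squared gradient difference
  (lemma \<open>subgradient_inequality_smooth\<close>).\<close>


section \<open>Inequalities for smooth functions\<close>

lemma descent_inequality:
  fixes h :: "'a::real_inner \<Rightarrow> real"
  assumes der: "\<And>x. GDERIV h x :> G x" and lip: "L-lipschitz_on UNIV G"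
  shows "h y \<le> h x + G x \<bullet> (y - x) + L / 2 * (norm (y - x))\<^sup>2"
proof -
  define v where "v = y - x"
  define \<psi> where "\<psi> t = h (x + t *\<^sub>R v) - t * (G x \<bullet> v) - L * t\<^sup>2 / 2 * (norm v)\<^sup>2" for t
  have d\<psi>: "(\<psi> has_real_derivative
      G (x + t *\<^sub>R v) \<bullet> v - G x \<bullet> v - L * t * (norm v)\<^sup>2) (at t)" for t
  proof -
    have "((\<lambda>t. h (x + t *\<^sub>R v)) has_derivative (\<lambda>s. (s *\<^sub>R v) \<bullet> G (x + t *\<^sub>R v))) (at t)"
      by (rule has_derivative_compose[of "\<lambda>t. x + t *\<^sub>R v" "\<lambda>s. s *\<^sub>R v"])
        (auto intro!: derivative_eq_intros der[unfolded gderiv_def])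
    hence "((\<lambda>t. h (x + t *\<^sub>R v)) has_real_derivative G (x + t *\<^sub>R v) \<bullet> v) (at t)"
      unfolding has_field_derivative_def
      by (rule has_derivative_eq_rhs) (auto simp: inner_commute mult.commute)
    thus ?thesis unfolding \<psi>_def by (auto intro!: derivative_eq_intros)
  qed
  have "G (x + t *\<^sub>R v) \<bullet> v - G x \<bullet> v - L * t * (norm v)\<^sup>2 \<le> 0" if "0 \<le> t" for t
  proof -
    have "G (x + t *\<^sub>R v) \<bullet> v - G x \<bullet> v \<le> norm (G (x + t *\<^sub>R v) - G x) * norm v"
      unfolding inner_diff_left[symmetric] by (rule norm_cauchy_schwarz)
    also have "\<dots> \<le> (L * norm (t *\<^sub>R v)) * norm v"
      using lipschitz_onD[OF lip, of "x + t *\<^sub>R v" x]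
      by (intro mult_right_mono) (auto simp: dist_norm)
    finally show ?thesis using that by (simp add: power2_eq_square)
  qed
  with d\<psi> have "\<exists>D. (\<psi> has_real_derivative D) (at t) \<and> D \<le> 0" if "0 \<le> t" for t
    using that by blast
  hence "\<psi> 1 \<le> \<psi> 0"
    by (intro DERIV_nonpos_imp_nonincreasing[of 0 1 \<psi>]) auto
  thus ?thesis unfolding \<psi>_def v_def by simp
qed

text \<open>The function \<open>\<lambda>z. h z - g \<bullet> z\<close> is minimal at \<open>x\<close>. By the descent inequality, a gradient
  step of length \<open>1 / L\<close> from \<open>y\<close> lowers it by at least \<open>1 / (2 * L)\<close> times the squared norm
  of its gradient \<open>G y - g\<close>, and the result still lies above the minimum.\<close>

lemma subgradient_inequality_smooth:
  fixes h :: "'a::real_inner \<Rightarrow> real"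
  assumes der: "\<And>x. GDERIV h x :> G x" and lip: "L-lipschitz_on UNIV G" and L: "L > 0"
    and sub: "\<And>z. h z \<ge> h x + g \<bullet> (z - x)"
  shows "h y \<ge> h x + g \<bullet> (y - x) + (norm (G y - g))\<^sup>2 / (2 * L)"
proof -
  define w where "w = G y - g"
  define z where "z = y - (1 / L) *\<^sub>R w"
  have "h x + g \<bullet> (z - x) \<le> h z" by (rule sub)
  also have "\<dots> \<le> h y + G y \<bullet> (z - y) + L / 2 * (norm (z - y))\<^sup>2"
    by (rule descent_inequality[OF der lip])
  finally have "h x + g \<bullet> (y - x) + (g \<bullet> (z - y) - G y \<bullet> (z - y)) \<le> h y + L / 2 * (norm (z - y))\<^sup>2"
    by (simp add: inner_diff_right)
  moreover have "g \<bullet> (z - y) - G y \<bullet> (z - y) = (norm w)\<^sup>2 / L"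
    unfolding inner_diff_left[symmetric]
    by (simp add: z_def w_def power2_norm_eq_inner inner_diff_left inner_diff_right diff_divide_distrib)
  moreover have "L / 2 * (norm (z - y))\<^sup>2 = (norm w)\<^sup>2 / (2 * L)"
    using L by (simp add: z_def power2_eq_square)
  moreover have "(norm w)\<^sup>2 / L = 2 * ((norm w)\<^sup>2 / (2 * L))" by simp
  ultimately show ?thesis unfolding w_def[symmetric] by linarith
qed

lemma subgradient_eq_gradient:
  fixes h :: "'a::real_inner \<Rightarrow> real"
  assumes der: "GDERIV h x :> D" and sub: "\<And>z. h z \<ge> h x + g \<bullet> (z - x)"
  shows "g = D"
proof -
  have "((\<lambda>z. h z - g \<bullet> (z - x)) has_derivative (\<lambda>v. v \<bullet> D - g \<bullet> v)) (at x)"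
    by (auto intro!: derivative_eq_intros der[unfolded gderiv_def])
  moreover have "\<forall>\<^sub>F z in at x. h x - g \<bullet> (x - x) \<le> h z - g \<bullet> (z - x)"
    using sub by (intro always_eventually) (simp add: le_diff_eq)
  ultimately have "(\<lambda>v. v \<bullet> D - g \<bullet> v) = (\<lambda>v. 0)"
    using has_derivative_local_min[of "\<lambda>z. h z - g \<bullet> (z - x)" "\<lambda>v. v \<bullet> D - g \<bullet> v" x] by simp
  hence "(D - g) \<bullet> D - g \<bullet> (D - g) = 0" by (rule fun_cong)
  hence "(D - g) \<bullet> (D - g) = 0"
    by (simp add: inner_diff_left inner_diff_right inner_commute)
  thus ?thesis by simp
qed


section \<open>Consequences of a step of the method\<close>

text \<open>Every trial point differs from \<open>y1\<close> and from \<open>y2\<close> by a combination of \<open>y1 - y2\<close>,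
  \<open>d1\<close> and \<open>d2\<close>, all orthogonal to the chosen subgradient.\<close>

lemma um_step_orthogonal:
  assumes "um_step f N x g i"
  shows "g i \<bullet> (x i - y1 x i) = 0" and "g i \<bullet> (x i - y2 N x i) = 0"
proof -
  obtain a b c where x: "x i = a *\<^sub>R y1 x i + (1 - a) *\<^sub>R y2 N x i - b *\<^sub>R d1 g i - c *\<^sub>R d2 N g i"
    using assms unfolding um_step_def um_point_def by auto
  have o: "g i \<bullet> y1 x i = g i \<bullet> y2 N x i" "g i \<bullet> d1 g i = 0" "g i \<bullet> d2 N g i = 0"
    using assms unfolding um_step_def by (auto simp: inner_diff_right)
  have "g i \<bullet> x i = g i \<bullet> y2 N x i"
    by (subst x) (simp add: inner_simps o algebra_simps)
  thus "g i \<bullet> (x i - y1 x i) = 0" "g i \<bullet> (x i - y2 N x i) = 0"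
    using o by (simp_all add: inner_diff_right)
qed

lemma subdiff_imp_finite:
  assumes "proper_fun f" and "g \<in> subdiff f x"
  shows "\<bar>f x\<bar> \<noteq> \<infinity>"
proof -
  obtain y where y: "f y < \<infinity>" using assms(1) unfolding proper_fun_def by auto
  have "f x + ereal (g \<bullet> (y - x)) \<le> f y" using assms(2) unfolding subdiff_def by auto
  hence "f x \<noteq> \<infinity>" using y by auto
  moreover have "f x \<noteq> -\<infinity>" using assms(1) unfolding proper_fun_def by (metis less_irrefl)
  ultimately show ?thesis by auto
qed

lemma argmin_iff_zero_subgradient: "x \<in> argmin f \<longleftrightarrow> 0 \<in> subdiff f x"
  by (simp add: argmin_def subdiff_def is_arg_min_linorder)


section \<open>Lipschitz continuous functions\<close>

text \<open>The weights \<open>i\<close> and \<open>1\<close> of the two inequalities at \<open>x i\<close> match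
  \<open>(i + 1) y1 = i x (i - 1) + x 0\<close>, so that their linear terms combine to
  \<open>g i \<bullet> (xs - x 0)\<close>.\<close>

lemma averaged_subgradient_bound:
  fixes x g :: "nat \<Rightarrow> 'a::real_inner"
  assumes "\<And>i. 1 \<le> i \<Longrightarrow> i \<le> N \<Longrightarrow> g i \<bullet> (x i - y1 x i) = 0"
    and "\<And>i. 1 \<le> i \<Longrightarrow> i \<le> N \<Longrightarrow> F (i - 1) \<ge> F i + g i \<bullet> (x (i - 1) - x i)"
    and "\<And>i. i \<le> N \<Longrightarrow> Fs \<ge> F i + g i \<bullet> (xs - x i)"
  shows "(real N + 1) * (F N - Fs) \<le> (\<Sum>i\<le>N. g i) \<bullet> (x 0 - xs)"
  using assms
proof (induction N)
  case 0
  from 0(3)[of 0] show ?case by (simp add: inner_diff_right)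
next
  case (Suc n)
  let ?k = "real n + 1"
  have IH: "?k * (F n - Fs) \<le> (\<Sum>i\<le>n. g i) \<bullet> (x 0 - xs)"
    using Suc.IH Suc.prems by simp
  have "(real n + 2) *\<^sub>R (x (Suc n) - y1 x (Suc n)) = (real n + 2) *\<^sub>R x (Suc n) - (?k *\<^sub>R x n + x 0)"
    by (simp add: y1_def scaleR_diff_right scaleR_add_right add.commute)
  hence "(real n + 2) * (g (Suc n) \<bullet> (x (Suc n) - y1 x (Suc n))) =
      g (Suc n) \<bullet> ((real n + 2) *\<^sub>R x (Suc n) - (?k *\<^sub>R x n + x 0))"
    by (simp only: inner_scaleR_right[symmetric])
  hence o: "(real n + 2) * (g (Suc n) \<bullet> x (Suc n)) = ?k * (g (Suc n) \<bullet> x n) + g (Suc n) \<bullet> x 0"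
    using Suc.prems(1)[of "Suc n"] by (simp add: inner_diff_right inner_add_right)
  have "?k * (F (Suc n) + g (Suc n) \<bullet> (x n - x (Suc n))) \<le> ?k * F n"
    using Suc.prems(2)[of "Suc n"] by (intro mult_left_mono) auto
  moreover have "F (Suc n) + g (Suc n) \<bullet> (xs - x (Suc n)) \<le> Fs"
    using Suc.prems(3)[of "Suc n"] by simp
  ultimately show ?case using IH o by (simp add: inner_simps algebra_simps)
qed

lemma norm_sum_subgradients_le:
  fixes g :: "nat \<Rightarrow> 'a::real_inner"
  assumes "\<And>i. 1 \<le> i \<Longrightarrow> i \<le> N \<Longrightarrow> g i \<bullet> d1 g i = 0"
    and "\<And>i. i \<le> N \<Longrightarrow> norm (g i) \<le> M"
  shows "(norm (\<Sum>i\<le>N. g i))\<^sup>2 \<le> (real N + 1) * M\<^sup>2"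
  using assms
proof (induction N)
  case 0
  thus ?case by (simp add: power_mono)
next
  case (Suc n)
  have "(norm (g (Suc n)))\<^sup>2 \<le> M\<^sup>2"
    using Suc.prems(2)[of "Suc n"] by (simp add: power_mono)
  moreover have "g (Suc n) \<bullet> (\<Sum>i\<le>n. g i) = 0"
    using Suc.prems(1)[of "Suc n"] by (simp add: d1_def lessThan_Suc_atMost)
  moreover have "(norm (\<Sum>i\<le>n. g i))\<^sup>2 \<le> (real n + 1) * M\<^sup>2"
    using Suc by simp
  ultimately show ?case
    by (simp add: power2_norm_eq_inner inner_simps inner_commute algebra_simps)
qed

lemma lipschitz_rate:
  fixes x g :: "nat \<Rightarrow> 'a::real_inner"
  assumes "\<And>i. 1 \<le> i \<Longrightarrow> i \<le> N \<Longrightarrow> g i \<bullet> (x i - y1 x i) = 0"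
    and "\<And>i. 1 \<le> i \<Longrightarrow> i \<le> N \<Longrightarrow> g i \<bullet> d1 g i = 0"
    and "\<And>i. 1 \<le> i \<Longrightarrow> i \<le> N \<Longrightarrow> F (i - 1) \<ge> F i + g i \<bullet> (x (i - 1) - x i)"
    and "\<And>i. i \<le> N \<Longrightarrow> Fs \<ge> F i + g i \<bullet> (xs - x i)"
    and "\<And>i. i \<le> N \<Longrightarrow> norm (g i) \<le> M"
    and "M \<ge> 0" and "norm (x 0 - xs) \<le> R"
  shows "F N - Fs \<le> M * R / sqrt (real N + 1)"
proof -
  let ?k = "sqrt (real N + 1)"
  have "(norm (\<Sum>i\<le>N. g i))\<^sup>2 \<le> (?k * M)\<^sup>2"
    using norm_sum_subgradients_le[of N g M] assms(2,5) by (simp add: power_mult_distrib)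
  hence nrm: "norm (\<Sum>i\<le>N. g i) \<le> ?k * M"
    by (rule power2_le_imp_le) (use assms(6) in simp)
  have "?k * (?k * (F N - Fs)) = (real N + 1) * (F N - Fs)"
    by (simp add: mult.assoc[symmetric])
  also have "\<dots> \<le> (\<Sum>i\<le>N. g i) \<bullet> (x 0 - xs)"
    by (rule averaged_subgradient_bound) (use assms in auto)
  also have "\<dots> \<le> norm (\<Sum>i\<le>N. g i) * norm (x 0 - xs)"
    by (rule norm_cauchy_schwarz)
  also have "\<dots> \<le> (?k * M) * R"
    using nrm assms(6,7) by (intro mult_mono) auto
  finally have "?k * (?k * (F N - Fs)) \<le> ?k * (M * R)" by (simp add: mult.assoc)
  hence "?k * (F N - Fs) \<le> M * R" by (rule mult_left_le_imp_le) simp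
  thus ?thesis by (simp add: pos_le_divide_eq mult.commute)
qed


section \<open>Smooth functions\<close>

lemma theta_ge_1: "theta N i \<ge> 1"
  by (induction i) (auto simp: real_le_rsqrt)

lemma theta_square:
  "(theta N (Suc i))\<^sup>2 = theta N (Suc i) + (if Suc i = N then 2 else 1) * (theta N i)\<^sup>2"
proof -
  have "((1 + sqrt (4 * a + 1)) / 2)\<^sup>2 = (1 + sqrt (4 * a + 1)) / 2 + a" if "a \<ge> 0" for a :: real
    using that by (simp add: power2_eq_square algebra_simps add_divide_distrib)
  from this[of "(theta N i)\<^sup>2"] this[of "2 * (theta N i)\<^sup>2"] show ?thesis by simp
qed

text \<open>The secondary sequence of the optimized gradient method with step size \<open>1 / L\<close>.\<close>

definition ogm_z :: "nat \<Rightarrow> real \<Rightarrow> (nat \<Rightarrow> 'a::real_vector) \<Rightarrow> (nat \<Rightarrow> 'a) \<Rightarrow> nat \<Rightarrow> 'a"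
  where "ogm_z N L x g i = x 0 - (2 / L) *\<^sub>R (\<Sum>j<i. theta N j *\<^sub>R g j)"

text \<open>This is the update \<open>x i = (1 - 1 / \<theta>\<^sub>i) (x (i - 1) - g (i - 1) / L) + z\<^sub>i / \<theta>\<^sub>i\<close> of the
  optimized gradient method, multiplied by \<open>\<theta>\<^sub>i\<^sup>2\<close> and tested against \<open>g i\<close>.\<close>

lemma ogm_step_inner:
  fixes x g :: "nat \<Rightarrow> 'a::real_inner"
  assumes "g (Suc n) \<bullet> (x (Suc n) - y2 N x (Suc n)) = 0" and "g (Suc n) \<bullet> d2 N g (Suc n) = 0"
  defines "t \<equiv> theta N (Suc n)"
  shows "t\<^sup>2 * (g (Suc n) \<bullet> x (Suc n)) =
    (t\<^sup>2 - t) * (g (Suc n) \<bullet> x n - g (Suc n) \<bullet> g n / L) + t * (g (Suc n) \<bullet> ogm_z N L x g (Suc n))"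
proof -
  have t: "t \<noteq> 0" using theta_ge_1[of N "Suc n"] unfolding t_def by simp
  let ?p = "g (Suc n)" and ?S = "\<Sum>j<Suc n. theta N j *\<^sub>R g j"
  have a: "?p \<bullet> x (Suc n) = (1 - 1 / t) * (?p \<bullet> x n) + (1 / t) * (?p \<bullet> x 0)"
    using assms(1) unfolding y2_def t_def[symmetric]
    by (simp only: inner_simps diff_Suc_1)
  have b: "0 = (1 - 1 / t) * (?p \<bullet> g n) + (2 / t) * (?p \<bullet> ?S)"
    using assms(2) unfolding d2_def t_def[symmetric]
    by (simp only: inner_simps diff_Suc_1)
  have z: "?p \<bullet> ogm_z N L x g (Suc n) = ?p \<bullet> x 0 - (2 / L) * (?p \<bullet> ?S)"
    unfolding ogm_z_def by (simp only: inner_simps)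
  have a': "t\<^sup>2 * (?p \<bullet> x (Suc n)) = (t\<^sup>2 - t) * (?p \<bullet> x n) + t * (?p \<bullet> x 0)"
    unfolding a using t by (simp add: field_simps power2_eq_square)
  have "0 = t\<^sup>2 * ((1 - 1 / t) * (?p \<bullet> g n) + (2 / t) * (?p \<bullet> ?S))"
    using b by simp
  also have "\<dots> = (t\<^sup>2 - t) * (?p \<bullet> g n) + 2 * t * (?p \<bullet> ?S)"
    using t by (simp add: field_simps power2_eq_square)
  finally have b': "(t\<^sup>2 - t) * (?p \<bullet> g n) = - 2 * t * (?p \<bullet> ?S)" by linarith
  have "(t\<^sup>2 - t) * (?p \<bullet> g n / L) = - t * ((2 / L) * (?p \<bullet> ?S))"
    using b' by simp
  thus ?thesis unfolding z a' by (simp add: algebra_simps)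
qed

text \<open>Consecutive terms of \<open>ogm_z\<close> differ by a multiple of one gradient; this is how the
  distance term of the potential changes.\<close>

lemma scaled_norm_square_step:
  fixes u p :: "'a::real_inner"
  assumes "L > 0"
  shows "L / 2 * (norm (u - (c / L) *\<^sub>R p))\<^sup>2 =
    L / 2 * (norm u)\<^sup>2 - c * (p \<bullet> u) + c\<^sup>2 / (2 * L) * (norm p)\<^sup>2"
proof -
  have "(norm (u - (c / L) *\<^sub>R p))\<^sup>2 =
      (norm u)\<^sup>2 - 2 * (c / L) * (p \<bullet> u) + (c / L)\<^sup>2 * (norm p)\<^sup>2"
    unfolding power2_norm_eq_inner
    by (simp add: inner_simps inner_commute power2_eq_square algebra_simps)
  thus ?thesis using assms by (simp add: field_simps power2_eq_square)
qed

text \<open>The left-hand side is the potential. It does not increase: its decrease from step \<open>n\<close> to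
  step \<open>n + 1\<close> is exactly \<open>2 * (theta N n)\<^sup>2\<close> times the slack in the
  smooth inequality from \<open>x (n + 1)\<close> to \<open>x n\<close> plus \<open>2 * theta N (n + 1)\<close> times the one from
  \<open>x (n + 1)\<close> to \<open>xs\<close>. The weights on \<open>F (n + 1)\<close> add up because
  \<open>(theta N (n + 1))\<^sup>2 - theta N (n + 1) = (theta N n)\<^sup>2\<close>, and the inner products cancel by
  \<open>ogm_step_inner\<close>.\<close>

lemma ogm_potential_bound:
  fixes x g :: "nat \<Rightarrow> 'a::real_inner"
  assumes L: "L > 0" and "n < N"
    and "\<And>i. 1 \<le> i \<Longrightarrow> i \<le> n \<Longrightarrow> g i \<bullet> (x i - y2 N x i) = 0"
    and "\<And>i. 1 \<le> i \<Longrightarrow> i \<le> n \<Longrightarrow> g i \<bullet> d2 N g i = 0"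
    and "\<And>i. 1 \<le> i \<Longrightarrow> i \<le> n \<Longrightarrow>
      F (i - 1) \<ge> F i + g i \<bullet> (x (i - 1) - x i) + (norm (g (i - 1) - g i))\<^sup>2 / (2 * L)"
    and "\<And>i. i \<le> n \<Longrightarrow> Fs \<ge> F i + g i \<bullet> (xs - x i) + (norm (g i))\<^sup>2 / (2 * L)"
  shows "2 * (theta N n)\<^sup>2 * (F n - Fs - (norm (g n))\<^sup>2 / (2 * L))
      + L / 2 * (norm (ogm_z N L x g (Suc n) - xs))\<^sup>2 \<le> L / 2 * (norm (x 0 - xs))\<^sup>2"
  using assms(2-)
proof (induction n)
  case 0
  have z: "ogm_z N L x g (Suc 0) - xs = (x 0 - xs) - (2 / L) *\<^sub>R g 0"
    by (simp add: ogm_z_def)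
  show ?case
    using 0(5)[of 0] unfolding z scaled_norm_square_step[OF L]
    by (simp add: inner_simps algebra_simps)
next
  case (Suc n)
  define t where "t = theta N (Suc n)"
  define s where "s = (theta N n)\<^sup>2"
  let ?p = "g (Suc n)" and ?q = "g n" and ?z = "ogm_z N L x g (Suc n)"
  have IH: "2 * s * (F n - Fs - (norm ?q)\<^sup>2 / (2 * L)) + L / 2 * (norm (?z - xs))\<^sup>2
      \<le> L / 2 * (norm (x 0 - xs))\<^sup>2"
    unfolding s_def using Suc by simp
  have t: "t\<^sup>2 = t + s" "t \<ge> 1"
    using theta_square[of N n] Suc.prems(1) theta_ge_1 unfolding t_def s_def by auto
  have s: "s \<ge> 0" by (simp add: s_def)
  have z: "ogm_z N L x g (Suc (Suc n)) - xs = (?z - xs) - ((2 * t) / L) *\<^sub>R ?p"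
    by (simp add: ogm_z_def t_def algebra_simps)
  have o: "(t + s) * (?p \<bullet> x (Suc n)) = s * (?p \<bullet> x n - ?p \<bullet> ?q / L) + t * (?p \<bullet> ?z)"
    using ogm_step_inner[OF Suc.prems(2,3)[of "Suc n"], where L = L]
    unfolding t_def[symmetric] t(1) by simp
  have nd: "(norm (?q - ?p))\<^sup>2 / (2 * L) =
      (norm ?q)\<^sup>2 / (2 * L) - ?p \<bullet> ?q / L + (norm ?p)\<^sup>2 / (2 * L)"
    using L by (simp add: power2_norm_eq_inner inner_simps inner_commute field_simps)
  have i1: "2 * s * (F (Suc n) + ?p \<bullet> (x n - x (Suc n)) + (norm (?q - ?p))\<^sup>2 / (2 * L)) \<le> 2 * s * F n"
    using Suc.prems(4)[of "Suc n"] s by (intro mult_left_mono) auto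
  have i2: "2 * t * (F (Suc n) + ?p \<bullet> (xs - x (Suc n)) + (norm ?p)\<^sup>2 / (2 * L)) \<le> 2 * t * Fs"
    using Suc.prems(5)[of "Suc n"] t(2) by (intro mult_left_mono) auto
  define P where "P = (norm ?p)\<^sup>2 / (2 * L)"
  define Q where "Q = (norm ?q)\<^sup>2 / (2 * L)"
  have sq: "(2 * t)\<^sup>2 / (2 * L) * (norm ?p)\<^sup>2 = 4 * (t + s) * P"
    unfolding P_def t(1)[symmetric] by (simp add: power2_eq_square)
  show ?case
    using IH i1 i2 o
    unfolding z scaled_norm_square_step[OF L] sq nd t_def[symmetric] t(1)
      P_def[symmetric] Q_def[symmetric]
    by (simp add: inner_simps algebra_simps)
qed

text \<open>The last coefficient satisfies \<open>(theta N N)\<^sup>2 - theta N N = 2 * (theta N (N - 1))\<^sup>2\<close>, so the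
  last step puts weight \<open>theta N N\<close>, half of the earlier pattern, on the inequality to \<open>xs\<close>.
  All terms in \<open>g N\<close> then complete the square
  \<open>L / 2 * (norm (ogm_z N L x g N - (theta N N / L) *\<^sub>R g N - xs))\<^sup>2\<close>, which is nonnegative.
  This is how the bound holds for \<open>F N - Fs\<close> itself, while the potential controls
  only \<open>F n - Fs - (norm (g n))\<^sup>2 / (2 * L)\<close>.\<close>

lemma ogm_final_bound:
  fixes x g :: "nat \<Rightarrow> 'a::real_inner"
  assumes L: "L > 0" and N: "N \<ge> 1"
    and y: "\<And>i. 1 \<le> i \<Longrightarrow> i \<le> N \<Longrightarrow> g i \<bullet> (x i - y2 N x i) = 0"
    and d: "\<And>i. 1 \<le> i \<Longrightarrow> i \<le> N \<Longrightarrow> g i \<bullet> d2 N g i = 0"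
    and sub: "\<And>i. 1 \<le> i \<Longrightarrow> i \<le> N \<Longrightarrow>
      F (i - 1) \<ge> F i + g i \<bullet> (x (i - 1) - x i) + (norm (g (i - 1) - g i))\<^sup>2 / (2 * L)"
    and subs: "\<And>i. i \<le> N \<Longrightarrow> Fs \<ge> F i + g i \<bullet> (xs - x i) + (norm (g i))\<^sup>2 / (2 * L)"
  shows "(theta N N)\<^sup>2 * (F N - Fs) \<le> L / 2 * (norm (x 0 - xs))\<^sup>2"
proof -
  obtain n where n: "N = Suc n" using N by (cases N) auto
  define t where "t = theta N (Suc n)"
  define s where "s = 2 * (theta N n)\<^sup>2"
  let ?p = "g (Suc n)" and ?q = "g n" and ?z = "ogm_z N L x g (Suc n)"
  have IH: "s * (F n - Fs - (norm ?q)\<^sup>2 / (2 * L)) + L / 2 * (norm (?z - xs))\<^sup>2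
      \<le> L / 2 * (norm (x 0 - xs))\<^sup>2"
    unfolding s_def by (rule ogm_potential_bound) (use assms n in auto)
  have t: "t\<^sup>2 = t + s" "t \<ge> 1"
    using theta_square[of N n] theta_ge_1 n unfolding t_def s_def by auto
  have s: "s \<ge> 0" by (simp add: s_def)
  have o: "(t + s) * (?p \<bullet> x (Suc n)) = s * (?p \<bullet> x n - ?p \<bullet> ?q / L) + t * (?p \<bullet> ?z)"
    using ogm_step_inner[OF y[of "Suc n"] d[of "Suc n"], where L = L] n
    unfolding t_def[symmetric] t(1) by (simp add: t_def[symmetric] t(1))
  have nd: "(norm (?q - ?p))\<^sup>2 / (2 * L) =
      (norm ?q)\<^sup>2 / (2 * L) - ?p \<bullet> ?q / L + (norm ?p)\<^sup>2 / (2 * L)"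
    using L by (simp add: power2_norm_eq_inner inner_simps inner_commute field_simps)
  have i1: "s * (F (Suc n) + ?p \<bullet> (x n - x (Suc n)) + (norm (?q - ?p))\<^sup>2 / (2 * L)) \<le> s * F n"
    using sub[of "Suc n"] s n by (intro mult_left_mono) auto
  have i2: "t * (F (Suc n) + ?p \<bullet> (xs - x (Suc n)) + (norm ?p)\<^sup>2 / (2 * L)) \<le> t * Fs"
    using subs[of "Suc n"] t(2) n by (intro mult_left_mono) auto
  define P where "P = (norm ?p)\<^sup>2 / (2 * L)"
  define Q where "Q = (norm ?q)\<^sup>2 / (2 * L)"
  have sq: "t\<^sup>2 / (2 * L) * (norm ?p)\<^sup>2 = (t + s) * P"
    unfolding P_def t(1)[symmetric] by simp
  have "0 \<le> L / 2 * (norm ((?z - xs) - (t / L) *\<^sub>R ?p))\<^sup>2" using L by simp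
  hence "(t + s) * (F (Suc n) - Fs) \<le> L / 2 * (norm (x 0 - xs))\<^sup>2"
    using IH i1 i2 o
    unfolding scaled_norm_square_step[OF L] sq nd P_def[symmetric] Q_def[symmetric]
    by (simp add: inner_simps algebra_simps)
  thus ?thesis using n t(1) unfolding t_def by simp
qed


section \<open>Convergence of the universal method\<close>

theorem corollary6:
  fixes f :: "'a::euclidean_space \<Rightarrow> ereal" and x0 xN :: 'a and N :: nat
  assumes "N \<ge> 1" and "um_output f x0 N xN"
  shows "(\<forall>M R. M \<ge> 0 \<and> R \<ge> 0 \<and> is_input (class_C M) R f x0 \<longrightarrow>
             f xN - min_val f \<le> ereal (M * R / sqrt (real N + 1))) \<and>
         (\<forall>L R. L > 0 \<and> R \<ge> 0 \<and> is_input (class_F L) R f x0 \<longrightarrow>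
             f xN - min_val f \<le> ereal (L * R\<^sup>2 / (2 * (theta N N)\<^sup>2)))"
proof -
  obtain x g where x0: "x 0 = x0" and g0: "g 0 \<in> subdiff f (x 0)"
    and step: "\<And>i. 1 \<le> i \<Longrightarrow> i \<le> N \<Longrightarrow> um_step f N x g i" and xN: "xN = x N"
    using assms(2) unfolding um_output_def by auto
  have g: "g i \<in> subdiff f (x i)" if "i \<le> N" for i
    using g0 step[of i] that unfolding um_step_def by (cases "i = 0") auto
  have sub: "f y \<ge> f (x i) + ereal (g i \<bullet> (y - x i))" if "i \<le> N" for i y
    using g[OF that] unfolding subdiff_def by auto
  have d: "g i \<bullet> d1 g i = 0" "g i \<bullet> d2 N g i = 0" if "1 \<le> i" "i \<le> N" for i
    using step[OF that] unfolding um_step_def by auto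
  note y = um_step_orthogonal[OF step]
  show ?thesis
  proof (intro conjI allI impI; elim conjE)
    fix M R :: real
    assume MR: "0 \<le> M" "0 \<le> R" "is_input (class_C M) R f x0"
    then obtain xs where xs: "xs \<in> argmin f" "norm (x0 - xs) \<le> R"
      and f: "proper_fun f" "\<And>x g. g \<in> subdiff f x \<Longrightarrow> norm g \<le> M"
      unfolding is_input_def class_C_def by auto
    define F where "F z = real_of_ereal (f z)" for z
    have fx: "f (x i) = ereal (F (x i))" if "i \<le> N" for i
      using subdiff_imp_finite[OF f(1) g[OF that]] by (simp add: F_def ereal_real')
    have fs: "f xs = ereal (F xs)"
      using subdiff_imp_finite[OF f(1)] xs(1) argmin_iff_zero_subgradient[of xs f]
      by (simp add: F_def ereal_real')
    have "F (x N) - F xs \<le> M * R / sqrt (real N + 1)"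
    proof (rule lipschitz_rate)
      show "F (x i) + g i \<bullet> (x (i - 1) - x i) \<le> F (x (i - 1))" if "1 \<le> i" "i \<le> N" for i
        using sub[of i "x (i - 1)"] fx[of i] fx[of "i - 1"] that by simp
      show "F (x i) + g i \<bullet> (xs - x i) \<le> F xs" if "i \<le> N" for i
        using sub[of i xs] fx[of i] fs that by simp
      show "norm (g i) \<le> M" if "i \<le> N" for i using f(2) g that by blast
    qed (use y d MR xs x0 in auto)
    thus "f xN - min_val f \<le> ereal (M * R / sqrt (real N + 1))"
      using fx[of N] fs xN min_val_eq[OF xs(1)] by simp
  next
    fix L R :: real
    assume LR: "0 < L" "0 \<le> R" "is_input (class_F L) R f x0"
    then obtain xs where xs: "xs \<in> argmin f" "norm (x0 - xs) \<le> R"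
      unfolding is_input_def by auto
    obtain h G where f: "f = (\<lambda>x. ereal (h x))" and der: "\<And>x. GDERIV h x :> G x"
      and lip: "L-lipschitz_on UNIV G"
      using LR(3) unfolding is_input_def class_F_def by auto
    have subh: "h z \<ge> h (x i) + g i \<bullet> (z - x i)" if "i \<le> N" for i z
      using sub[OF that, of z] by (simp add: f)
    have gG: "g i = G (x i)" if "i \<le> N" for i
      by (rule subgradient_eq_gradient[OF der subh[OF that]])
    have Gs: "G xs = 0"
      by (rule subgradient_eq_gradient[OF der, symmetric])
        (use xs(1) in \<open>simp add: argmin_def is_arg_min_linorder f\<close>)
    note ineq = subgradient_inequality_smooth[OF der lip LR(1) subh]
    have "(theta N N)\<^sup>2 * (h (x N) - h xs) \<le> L / 2 * (norm (x 0 - xs))\<^sup>2"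
    proof (rule ogm_final_bound)
      show "h (x i) + g i \<bullet> (x (i - 1) - x i) + (norm (g (i - 1) - g i))\<^sup>2 / (2 * L) \<le> h (x (i - 1))"
        if "1 \<le> i" "i \<le> N" for i
        using ineq[of i "x (i - 1)"] gG[of "i - 1"] that by simp
      show "h (x i) + g i \<bullet> (xs - x i) + (norm (g i))\<^sup>2 / (2 * L) \<le> h xs" if "i \<le> N" for i
        using ineq[of i xs] Gs that by simp
    qed (use y d LR assms(1) in auto)
    also have "\<dots> \<le> L / 2 * R\<^sup>2"
      using xs(2) x0 LR by (intro mult_left_mono power_mono) auto
    finally have "h (x N) - h xs \<le> L * R\<^sup>2 / (2 * (theta N N)\<^sup>2)"
      using theta_ge_1[of N N] by (simp add: field_simps)
    thus "f xN - min_val f \<le> ereal (L * R\<^sup>2 / (2 * (theta N N)\<^sup>2))"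
      using xN min_val_eq[OF xs(1)] by (simp add: f)
  qed
qed

end
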